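(* Let $\mathbb{G}$ be a stratified group with $N$ the dimension of its first stratum and with generators $X_1,\ldots,X_N$ of the first stratum, and let $\Omega\subset\mathbb{G}$ be an open set. Let $p_i>1$ for $i=1,\ldots,N$. Let $u,v$ be twice differentiable a.e. in $\Omega$ and satisfy $u\ge 0$, $v>0$, and $X_i^2v<0$ a.e. in $\Omega$ for $i=1,\ldots,N$. Then $$L_1(u,v)=R_1(u,v)\ge 0,$$ where $$R_1(u,v):=\sum_{i=1}^{N}|X_i^2u|^{p_i}-\sum_{i=1}^{N}X_i^2\left(\frac{u^{p_i}}{v^{p_i-1}}\right)|X_i^2v|^{p_i-2}X_i^2v$$ and $$L_1(u,v):=\sum_{i=1}^{N}|X_i^2u|^{p_i}-\sum_{i=1}^{N}p_i\left(\frac{u}{v}\right)^{p_i-1}X_i^2u\,X_i^2v\,|X_i^2v|^{p_i-2}+\sum_{i=1}^{N}(p_i-1)\left(\frac{u}{v}\right)^{p_i}|X_i^2v|^{p_i}$$ $$-\sum_{i=1}^{N}p_i(p_i-1)\frac{u^{p_i-2}}{v^{p_i-1}}|X_i^2v|^{p_i-2}X_i^2v\left(X_iu-\frac{u}{v}X_iv\right)^2.$$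
   Context: A stratified group (homogeneous Carnot group) $\mathbb{G}=(\mathbb{R}^d,\circ,\delta_\lambda)$ of step $r$ is a Lie group structure on $\mathbb{R}^d$, with points written $x=(x',x^{(2)},\ldots,x^{(r)})$, $x'=(x'_1,\ldots,x'_N)\in\mathbb{R}^N$, $x^{(l)}=(x^{(l)}_1,\ldots,x^{(l)}_{N_l})\in\mathbb{R}^{N_l}$, such that the dilations $\delta_\lambda(x)=(\lambda x',\lambda^2x^{(2)},\ldots,\lambda^rx^{(r)})$, $\lambda>0$, are group automorphisms, and such that the left-invariant vector fields $X_1,\ldots,X_N$ with $X_k(0)=\partial/\partial x'_k|_0$ (the Jacobian generators of the first stratum) generate, together with their iterated commutators, the whole Lie algebra. Explicitly, $X_k=\frac{\partial}{\partial x'_k}+\sum_{l=2}^{r}\sum_{m=1}^{N_l}a^{(l)}_{k,m}(x',\ldots,x^{(l-1)})\frac{\partial}{\partial x^{(l)}_m}$. $X_i^2f=X_i(X_if)$. "A.e." refers to Lebesgue measure on $\mathbb{R}^d$, which is the Haar measure of $\mathbb{G}$. *)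

theory Defs
  imports "HOL-Analysis.Analysis" "HOL-Algebra.Group"
begin

primrec C_k :: "nat \<Rightarrow> ('a::euclidean_space \<Rightarrow> 'b::real_normed_vector) \<Rightarrow> bool" where
  "C_k 0 f \<longleftrightarrow> continuous_on UNIV f"
| "C_k (Suc n) f \<longleftrightarrow> (\<forall>x. f differentiable at x) \<and>
     (\<forall>b\<in>Basis. C_k n (\<lambda>x. frechet_derivative f (at x) b))"

definition smooth :: "('a::euclidean_space \<Rightarrow> 'b::real_normed_vector) \<Rightarrow> bool" where
  "smooth f \<longleftrightarrow> (\<forall>n. C_k n f)"

definition lie_bracket ::
  "('a \<Rightarrow> 'a) \<Rightarrow> ('a \<Rightarrow> 'a) \<Rightarrow> 'a \<Rightarrow> 'a::real_normed_vector" where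
  "lie_bracket V W = (\<lambda>x. frechet_derivative W (at x) (V x) - frechet_derivative V (at x) (W x))"

inductive_set generated_lie_algebra ::
  "('a \<Rightarrow> 'a::real_normed_vector) set \<Rightarrow> ('a \<Rightarrow> 'a) set"
  for S :: "('a \<Rightarrow> 'a::real_normed_vector) set" where
  base: "V \<in> S \<Longrightarrow> V \<in> generated_lie_algebra S"
| zero: "(\<lambda>x. 0) \<in> generated_lie_algebra S"
| add: "V \<in> generated_lie_algebra S \<Longrightarrow> W \<in> generated_lie_algebra S \<Longrightarrow>
    (\<lambda>x. V x + W x) \<in> generated_lie_algebra S"
| scale: "V \<in> generated_lie_algebra S \<Longrightarrow> (\<lambda>x. c *\<^sub>R V x) \<in> generated_lie_algebra S"
| bracket: "V \<in> generated_lie_algebra S \<Longrightarrow> W \<in> generated_lie_algebra S \<Longrightarrow>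
    lie_bracket V W \<in> generated_lie_algebra S"

definition left_invariant :: "(real^'d) monoid \<Rightarrow> (real^'d \<Rightarrow> real^'d) \<Rightarrow> bool" where
  "left_invariant G V \<longleftrightarrow>
     (\<forall>x y. V (x \<otimes>\<^bsub>G\<^esub> y) = frechet_derivative (\<lambda>z. x \<otimes>\<^bsub>G\<^esub> z) (at y) (V y))"

text \<open>
  The vector field of the Jacobian generator \<open>X\<^sub>k\<close>: the vector \<open>\<partial>/\<partial>x\<^sub>k\<close> at the origin, pushed
  forward by left translations. See \<open>jacobian_field_unique\<close> below: on a stratified group it is
  the only left-invariant vector field with that value at the origin.
\<close>

definition jacobian_field :: "(real^'d) monoid \<Rightarrow> 'd \<Rightarrow> real^'d \<Rightarrow> real^'d" where
  "jacobian_field G k x = frechet_derivative (\<lambda>z. x \<otimes>\<^bsub>G\<^esub> z) (at 0) (axis k 1)"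

text \<open>
  Coordinates are indexed by a finite type, and \<open>\<sigma> i\<close> is the stratum to which coordinate \<open>i\<close>
  belongs. Thus \<open>{i. \<sigma> i = l}\<close> has \<open>N\<^sub>l\<close> elements, and \<open>{i. \<sigma> i = 1}\<close> plays the role
  of \<open>{1, \<dots>, N}\<close>.
\<close>

definition dilation :: "('d \<Rightarrow> nat) \<Rightarrow> real \<Rightarrow> real^'d \<Rightarrow> real^'d" where
  "dilation \<sigma> c x = (\<chi> i. c ^ \<sigma> i * x $ i)"

definition first_stratum :: "('d \<Rightarrow> nat) \<Rightarrow> 'd set" where
  "first_stratum \<sigma> = {i. \<sigma> i = 1}"

locale stratified_group = group G
  for G :: "(real^'d) monoid" +
  fixes \<sigma> :: "'d \<Rightarrow> nat" and r :: nat
  assumes carrier_UNIV: "carrier G = UNIV"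
    and smooth_mult: "smooth (\<lambda>z. fst z \<otimes>\<^bsub>G\<^esub> snd z)"
    and smooth_inv: "smooth (\<lambda>x. inv\<^bsub>G\<^esub> x)"
    and strata: "range \<sigma> = {1..r}"
    and dilation_iso: "c > 0 \<Longrightarrow> dilation \<sigma> c \<in> iso G G"
    and generates: "generated_lie_algebra (jacobian_field G ` first_stratum \<sigma>)
                      = {V. left_invariant G V}"

lemma (in stratified_group) one_eq_0: "\<one>\<^bsub>G\<^esub> = 0"
proof -
  have "dilation \<sigma> 2 \<in> hom G G"
    using dilation_iso[of 2] by (simp add: iso_def)
  then have "dilation \<sigma> 2 \<one>\<^bsub>G\<^esub> = \<one>\<^bsub>G\<^esub>"
    using hom_one is_group by blast
  then have *: "2 ^ \<sigma> i * \<one>\<^bsub>G\<^esub> $ i = \<one>\<^bsub>G\<^esub> $ i" for i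
    by (metis dilation_def vec_lambda_beta)
  have "\<one>\<^bsub>G\<^esub> $ i = 0" for i
  proof -
    have "\<sigma> i \<in> {1..r}" using strata by blast
    then have "(2::real) ^ \<sigma> i > 1"
      by (intro one_less_power) auto
    with *[of i] show ?thesis
      by simp
  qed
  then show ?thesis
    by (simp add: vec_eq_iff)
qed

lemma (in stratified_group) differentiable_left_translation:
  "(\<lambda>z. x \<otimes>\<^bsub>G\<^esub> z) differentiable at y"
proof -
  have "C_k (Suc 0) (\<lambda>z. fst z \<otimes>\<^bsub>G\<^esub> snd z)"
    using smooth_mult unfolding smooth_def by blast
  then have "(\<lambda>z. fst z \<otimes>\<^bsub>G\<^esub> snd z) differentiable at (x, y)"
    by simp
  moreover have "(\<lambda>z. (x, z)) differentiable at y"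
    by (auto simp: differentiable_def intro!: exI derivative_eq_intros)
  ultimately have "((\<lambda>z. fst z \<otimes>\<^bsub>G\<^esub> snd z) \<circ> (\<lambda>z. (x, z))) differentiable at y"
    by (intro differentiable_chain_at) auto
  then show ?thesis
    by (simp add: o_def)
qed

theorem (in stratified_group) jacobian_field_unique:
  "left_invariant G V \<and> V 0 = axis k 1 \<longleftrightarrow> V = jacobian_field G k"
proof
  assume V: "left_invariant G V \<and> V 0 = axis k 1"
  show "V = jacobian_field G k"
  proof
    fix x
    have "V (x \<otimes>\<^bsub>G\<^esub> 0) = frechet_derivative (\<lambda>z. x \<otimes>\<^bsub>G\<^esub> z) (at 0) (V 0)"
      using V unfolding left_invariant_def by blast
    moreover have "x \<otimes>\<^bsub>G\<^esub> 0 = x"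
      using r_one[of x] by (simp add: one_eq_0 carrier_UNIV)
    ultimately show "V x = jacobian_field G k x"
      using V by (simp add: jacobian_field_def)
  qed
next
  assume V: "V = jacobian_field G k"
  have r1: "x \<otimes>\<^bsub>G\<^esub> 0 = x" "0 \<otimes>\<^bsub>G\<^esub> x = x" for x
    using r_one[of x] l_one[of x] by (simp_all add: one_eq_0 carrier_UNIV)
  have "jacobian_field G k (x \<otimes>\<^bsub>G\<^esub> y) =
      frechet_derivative (\<lambda>z. x \<otimes>\<^bsub>G\<^esub> z) (at y) (jacobian_field G k y)" for x y
  proof -
    have "(\<lambda>z. (x \<otimes>\<^bsub>G\<^esub> y) \<otimes>\<^bsub>G\<^esub> z) = (\<lambda>z. x \<otimes>\<^bsub>G\<^esub> z) \<circ> (\<lambda>z. y \<otimes>\<^bsub>G\<^esub> z)"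
      by (auto simp: fun_eq_iff m_assoc carrier_UNIV)
    moreover have "frechet_derivative ((\<lambda>z. x \<otimes>\<^bsub>G\<^esub> z) \<circ> (\<lambda>z. y \<otimes>\<^bsub>G\<^esub> z)) (at 0) =
        frechet_derivative (\<lambda>z. x \<otimes>\<^bsub>G\<^esub> z) (at (y \<otimes>\<^bsub>G\<^esub> 0)) \<circ>
        frechet_derivative (\<lambda>z. y \<otimes>\<^bsub>G\<^esub> z) (at 0)"
      by (rule frechet_derivative_compose) (rule differentiable_left_translation)+
    ultimately show ?thesis
      unfolding jacobian_field_def by (simp only: r1 o_apply)
  qed
  moreover have "jacobian_field G k 0 = axis k 1"
    by (simp add: jacobian_field_def r1)
  ultimately show "left_invariant G V \<and> V 0 = axis k 1"
    using V by (simp add: left_invariant_def)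
qed

text \<open>The derivation \<open>f \<mapsto> X\<^sub>k f\<close>, meaningful at points where \<open>f\<close> is differentiable.\<close>

definition XD :: "(real^'d) monoid \<Rightarrow> 'd \<Rightarrow> (real^'d \<Rightarrow> real) \<Rightarrow> real^'d \<Rightarrow> real" where
  "XD G k f = (\<lambda>x. frechet_derivative f (at x) (jacobian_field G k x))"

abbreviation XD2 :: "(real^'d) monoid \<Rightarrow> 'd \<Rightarrow> (real^'d \<Rightarrow> real) \<Rightarrow> real^'d \<Rightarrow> real" where
  "XD2 G k f \<equiv> XD G k (XD G k f)"

definition twice_differentiable_at ::
  "('a::real_normed_vector \<Rightarrow> 'b::real_normed_vector) \<Rightarrow> 'a \<Rightarrow> bool" where
  "twice_differentiable_at f x \<longleftrightarrow>
     (\<exists>f' :: 'a \<Rightarrow> 'a \<Rightarrow>\<^sub>L 'b.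
        (\<forall>\<^sub>F y in nhds x. (f has_derivative blinfun_apply (f' y)) (at y)) \<and> f' differentiable at x)"

text \<open>
  Powers of nonnegative reals are taken with \<open>powr\<close>, for which \<open>0 powr a = 0\<close> for every \<open>a\<close>.
  The exponent \<open>p i - 2\<close> may be nonpositive; for the base \<open>u\<close> this only concerns points where
  \<open>u = 0\<close>, and for a nonnegative \<open>u\<close> differentiable near such a point the squared factor
  multiplying \<open>u powr (p i - 2)\<close> in \<open>L1\<close> vanishes.
\<close>

definition R1 :: "(real^'d) monoid \<Rightarrow> ('d \<Rightarrow> nat) \<Rightarrow> ('d \<Rightarrow> real) \<Rightarrow>
    (real^'d \<Rightarrow> real) \<Rightarrow> (real^'d \<Rightarrow> real) \<Rightarrow> real^'d \<Rightarrow> real" where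
  "R1 G \<sigma> p u v x =
     (\<Sum>i\<in>first_stratum \<sigma>. \<bar>XD2 G i u x\<bar> powr p i)
     - (\<Sum>i\<in>first_stratum \<sigma>.
          XD2 G i (\<lambda>y. u y powr p i / v y powr (p i - 1)) x * \<bar>XD2 G i v x\<bar> powr (p i - 2) * XD2 G i v x)"

definition L1 :: "(real^'d) monoid \<Rightarrow> ('d \<Rightarrow> nat) \<Rightarrow> ('d \<Rightarrow> real) \<Rightarrow>
    (real^'d \<Rightarrow> real) \<Rightarrow> (real^'d \<Rightarrow> real) \<Rightarrow> real^'d \<Rightarrow> real" where
  "L1 G \<sigma> p u v x =
     (\<Sum>i\<in>first_stratum \<sigma>. \<bar>XD2 G i u x\<bar> powr p i)
     - (\<Sum>i\<in>first_stratum \<sigma>.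
          p i * (u x / v x) powr (p i - 1) * XD2 G i u x * XD2 G i v x * \<bar>XD2 G i v x\<bar> powr (p i - 2))
     + (\<Sum>i\<in>first_stratum \<sigma>.
          (p i - 1) * (u x / v x) powr p i * \<bar>XD2 G i v x\<bar> powr p i)
     - (\<Sum>i\<in>first_stratum \<sigma>.
          p i * (p i - 1) * (u x powr (p i - 2) / v x powr (p i - 1))
          * \<bar>XD2 G i v x\<bar> powr (p i - 2) * XD2 G i v x * (XD G i u x - u x / v x * XD G i v x)\<^sup>2)"

end

theory Submission
  imports Defs
begin

text \<open>
  Write \<open>t = u / v\<close>. Since \<open>u\<^sup>p / v\<^sup>p\<^sup>-\<^sup>1 = v t\<^sup>p\<close>, the product and chain rules for the derivation \<open>X = X\<^sub>i\<close> give
  \<open>X (v t\<^sup>p) = p t\<^sup>p\<^sup>-\<^sup>1 X u - (p - 1) t\<^sup>p X v\<close>. Applying \<open>X\<close> once more, and using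
  \<open>X t = (X u - t X v) / v\<close>, the terms with first derivatives combine to a square:
  \<open>X\<^sup>2 (v t\<^sup>p) = p t\<^sup>p\<^sup>-\<^sup>1 X\<^sup>2 u - (p - 1) t\<^sup>p X\<^sup>2 v + p (p - 1) u\<^sup>p\<^sup>-\<^sup>2 / v\<^sup>p\<^sup>-\<^sup>1 (X u - t X v)\<^sup>2\<close>
  (lemma \<open>XD2_picone_quotient\<close>). Multiplying by \<open>|X\<^sup>2 v|\<^sup>p\<^sup>-\<^sup>2 X\<^sup>2 v\<close> and subtracting from \<open>|X\<^sup>2 u|\<^sup>p\<close>
  turns \<open>R\<^sub>1\<close> into \<open>L\<^sub>1\<close>. In \<open>L\<^sub>1\<close> the square enters with the sign of \<open>- X\<^sup>2 v > 0\<close>, and the other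
  three terms are nonnegative by Young's inequality for \<open>|X\<^sup>2 u|\<close> and \<open>t |X\<^sup>2 v|\<close>
  (lemma \<open>picone_young_nonneg\<close>).

  The delicate points are those with \<open>u = 0\<close>, where \<open>t\<^sup>p\<^sup>-\<^sup>1\<close> need not be differentiable. Near a point
  of twice differentiability \<open>u\<close> is continuous, so \<open>u \<ge> 0\<close> almost everywhere implies
  \<open>u \<ge> 0\<close> in a whole neighbourhood (lemma \<open>AE_nonneg_imp_eventually_nonneg\<close>). A zero of \<open>u\<close> is then
  a local minimum, so that \<open>X u\<close> vanishes there. The product \<open>t\<^sup>p\<^sup>-\<^sup>1 X u\<close> is therefore
  differentiable at the zero even though one factor is only continuous
  (lemma \<open>has_derivative_mult_vanishing\<close>), and the formula for \<open>X\<^sup>2 (v t\<^sup>p)\<close> remains true, both sides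
  being \<open>0\<close>.
\<close>

section \<open>Differentiation in normed spaces\<close>

lemma has_derivative_cong_nhds:
  assumes "(f has_derivative f') (at x)" "\<forall>\<^sub>F y in nhds x. f y = g y"
  shows "(g has_derivative f') (at x)"
  by (rule has_derivative_transform_eventually[OF assms(1)])
    (use assms(2) eventually_nhds_x_imp_x[OF assms(2)] in \<open>auto simp: eventually_at_filter elim: eventually_mono\<close>)

lemma isCont_imp_eventually_pos:
  fixes f :: "'a::t2_space \<Rightarrow> real"
  assumes "isCont f x" "0 < f x"
  shows "\<forall>\<^sub>F y in nhds x. 0 < f y"
  using assms by (intro order_tendstoD(1)[of f "f x"]) (simp_all add: continuous_at tendsto_at_iff_tendsto_nhds)

text \<open>
  Where \<open>b\<close> vanishes, the product rule would multiply the derivative of \<open>a\<close> by \<open>0\<close>. Continuity of \<open>a\<close>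
  suffices: \<open>a b = a(x) b + (a - a(x)) b\<close>, and in the second summand a null factor meets
  \<open>b = O(|y - x|)\<close>. This is what allows powers \<open>t\<^sup>p\<^sup>-\<^sup>1\<close> with \<open>0 < p - 1 < 1\<close> at zeros of \<open>t\<close>.
\<close>

lemma has_derivative_mult_vanishing:
  fixes a b :: "'a::real_normed_vector \<Rightarrow> real"
  assumes a: "isCont a x" and b: "(b has_derivative b') (at x)" and "b x = 0"
  shows "((\<lambda>y. a y * b y) has_derivative (\<lambda>h. a x * b' h)) (at x)"
proof -
  interpret bounded_linear b'
    using b by (rule has_derivative_bounded_linear)
  obtain K where nonneg_K: "0 \<le> K" and K: "\<And>h. norm (b' h) \<le> norm h * K"
    using nonneg_bounded by blast
  have lim_a: "((\<lambda>y. a y - a x) \<longlongrightarrow> 0) (at x)"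
    using a by (simp add: isCont_def LIM_zero)
  \<comment> \<open>The normalised remainder of \<open>a b\<close> is \<open>a\<close> times that of \<open>b\<close>, plus \<open>a - a(x)\<close> times a factor bounded by \<open>K\<close>.\<close>
  have "((\<lambda>y. a y * (1 / norm (y - x) * (b y - (b x + b' (y - x))))) \<longlongrightarrow> a x * 0) (at x)"
    using a b by (intro tendsto_mult) (simp_all add: isCont_def has_derivative_at2)
  moreover have "((\<lambda>y. (a y - a x) * (1 / norm (y - x) * b' (y - x))) \<longlongrightarrow> 0) (at x)"
  proof (rule Lim_null_comparison)
    show "\<forall>\<^sub>F y in at x. norm ((a y - a x) * (1 / norm (y - x) * b' (y - x))) \<le> \<bar>a y - a x\<bar> * K"
    proof (intro always_eventually allI)
      fix y
      have "\<bar>b' (y - x)\<bar> / norm (y - x) \<le> K" if "y \<noteq> x"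
        using K[of "y - x"] that by (simp add: divide_le_eq mult.commute)
      then have "\<bar>a y - a x\<bar> * (\<bar>b' (y - x)\<bar> / norm (y - x)) \<le> \<bar>a y - a x\<bar> * K" if "y \<noteq> x"
        using that by (intro mult_left_mono) auto
      then show "norm ((a y - a x) * (1 / norm (y - x) * b' (y - x))) \<le> \<bar>a y - a x\<bar> * K"
        using nonneg_K by (cases "y = x") (auto simp: abs_mult)
    qed
    show "((\<lambda>y. \<bar>a y - a x\<bar> * K) \<longlongrightarrow> 0) (at x)"
      using tendsto_mult_right[OF tendsto_rabs[OF lim_a], of K] by simp
  qed
  ultimately have "((\<lambda>y. a y * (1 / norm (y - x) * (b y - (b x + b' (y - x))))
      + (a y - a x) * (1 / norm (y - x) * b' (y - x))) \<longlongrightarrow> 0) (at x)"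
    using tendsto_add by fastforce
  moreover have "bounded_linear (\<lambda>h. a x * b' h)"
    by (rule bounded_linear_const_mult[OF bounded_linear_axioms])
  ultimately show ?thesis
    unfolding has_derivative_at2 using \<open>b x = 0\<close>
    by (simp add: algebra_simps diff_divide_distrib)
qed

lemma has_derivative_zero_of_nonneg:
  fixes f :: "'a::real_normed_vector \<Rightarrow> real"
  assumes "(f has_derivative f') (at x)" "\<forall>\<^sub>F y in nhds x. 0 \<le> f y" "f x = 0"
  shows "f' h = 0"
proof -
  have "\<forall>\<^sub>F y in at x. f x \<le> f y"
    using assms(2,3) by (simp add: eventually_at_filter eventually_mono)
  then show ?thesis
    using has_derivative_local_min[OF assms(1)] by simp
qed

lemma isCont_powr_nonneg:
  fixes f :: "'a::real_normed_vector \<Rightarrow> real"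
  assumes "isCont f x" "\<forall>\<^sub>F y in nhds x. 0 \<le> f y" "q > 0"
  shows "isCont (\<lambda>y. f y powr q) x"
  unfolding isCont_def
  by (rule tendsto_powr') (use assms in \<open>auto simp: isCont_def eventually_at_filter elim: eventually_mono\<close>)

lemma has_derivative_powr_pos:
  fixes f :: "'a::real_normed_vector \<Rightarrow> real"
  assumes "(f has_derivative f') (at x)" "f x > 0"
  shows "((\<lambda>y. f y powr q) has_derivative (\<lambda>h. q * f x powr (q - 1) * f' h)) (at x)"
  using DERIV_compose_FDERIV[OF has_real_derivative_powr[OF assms(2)] assms(1), of q]
  by (simp add: mult.commute)

text \<open>
  The chain rule for \<open>s \<mapsto> s\<^sup>q\<close> persists at a zero of \<open>f\<close>, where \<open>f\<^sup>q = f\<^sup>q\<^sup>-\<^sup>1 f\<close> is a continuous function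
  times a vanishing differentiable one.
\<close>

lemma has_derivative_powr_nonneg:
  fixes f :: "'a::real_normed_vector \<Rightarrow> real"
  assumes f: "(f has_derivative f') (at x)" and nonneg: "\<forall>\<^sub>F y in nhds x. 0 \<le> f y" and "q > 1"
  shows "((\<lambda>y. f y powr q) has_derivative (\<lambda>h. q * f x powr (q - 1) * f' h)) (at x)"
proof (cases "f x = 0")
  case True
  have "isCont f x"
    using f by (rule has_derivative_continuous)
  then have "isCont (\<lambda>y. f y powr (q - 1)) x"
    using nonneg \<open>q > 1\<close> by (intro isCont_powr_nonneg) auto
  from has_derivative_mult_vanishing[OF this f True]
  have "((\<lambda>y. f y powr (q - 1) * f y) has_derivative (\<lambda>h. q * f x powr (q - 1) * f' h)) (at x)"
    using True by simp
  moreover have "\<forall>\<^sub>F y in nhds x. f y powr (q - 1) * f y = f y powr q"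
    using nonneg by eventually_elim (auto simp: powr_diff)
  ultimately show ?thesis
    by (rule has_derivative_cong_nhds)
next
  case False
  then have "f x > 0"
    using eventually_nhds_x_imp_x[OF nonneg] by simp
  then show ?thesis
    by (rule has_derivative_powr_pos[OF f])
qed

section \<open>Derivatives along the Jacobian generators\<close>

lemma XD_eqI: "(f has_derivative f') (at x) \<Longrightarrow> XD G k f x = f' (jacobian_field G k x)"
  unfolding XD_def using frechet_derivative_at by metis

lemma twice_differentiable_at_imp_eventually_differentiable:
  "twice_differentiable_at f x \<Longrightarrow> \<forall>\<^sub>F y in nhds x. f differentiable at y"
  unfolding twice_differentiable_at_def differentiable_def by (auto elim: eventually_mono)

text \<open>
  The field \<open>X\<^sub>k\<close> is a partial derivative of the smooth group law at the points \<open>(x, 0)\<close>; this gives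
  its differentiability in \<open>x\<close>, which a second application of \<open>X\<^sub>k\<close> needs.
\<close>

lemma (in stratified_group) jacobian_field_differentiable: "jacobian_field G k differentiable at x"
proof -
  let ?m = "\<lambda>z. fst z \<otimes>\<^bsub>G\<^esub> snd z"
  have C2: "C_k (Suc (Suc 0)) ?m"
    using smooth_mult unfolding smooth_def by blast
  have field: "jacobian_field G k = (\<lambda>x. frechet_derivative ?m (at (x, 0)) (0, axis k 1))"
  proof
    fix x
    have "(?m has_derivative frechet_derivative ?m (at (x, 0))) (at (x, 0))"
      using C2 by (simp add: frechet_derivative_works)
    moreover have "(Pair x has_derivative (\<lambda>h. (0, h))) (at 0)"
      by (auto intro!: derivative_eq_intros)
    ultimately have "(?m \<circ> Pair x has_derivative frechet_derivative ?m (at (x, 0)) \<circ> (\<lambda>h. (0, h))) (at 0)"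
      by (intro diff_chain_at) auto
    from frechet_derivative_at[OF this]
    show "jacobian_field G k x = frechet_derivative ?m (at (x, 0)) (0, axis k 1)"
      by (simp add: jacobian_field_def o_def fun_eq_iff)
  qed
  have "(0, axis k 1) \<in> (Basis :: ((real^'d) \<times> (real^'d)) set)"
    by (simp add: Basis_prod_def axis_in_Basis_iff)
  then have "(\<lambda>z. frechet_derivative ?m (at z) (0, axis k 1)) differentiable at (x, 0)"
    using C2 by auto
  moreover have "(\<lambda>x. (x, 0)) differentiable at x"
    by (auto simp: differentiable_def intro!: exI derivative_eq_intros)
  ultimately have "((\<lambda>z. frechet_derivative ?m (at z) (0, axis k 1)) \<circ> (\<lambda>x. (x, 0))) differentiable at x"
    by (intro differentiable_chain_at) auto
  then show ?thesis
    by (simp add: field o_def)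
qed

lemma (in stratified_group) XD_differentiable:
  assumes "twice_differentiable_at f x"
  shows "XD G k f differentiable at x"
proof -
  obtain f' :: "real^'d \<Rightarrow> (real^'d) \<Rightarrow>\<^sub>L real"
    where f': "\<forall>\<^sub>F y in nhds x. (f has_derivative blinfun_apply (f' y)) (at y)"
      and "f' differentiable at x"
    using assms unfolding twice_differentiable_at_def by blast
  then have "(\<lambda>y. blinfun_apply (f' y) (jacobian_field G k y)) differentiable at x"
    using jacobian_field_differentiable[of k x]
    unfolding differentiable_def by (blast intro: bounded_bilinear.FDERIV[OF bounded_bilinear_blinfun_apply])
  moreover have "\<forall>\<^sub>F y in nhds x. blinfun_apply (f' y) (jacobian_field G k y) = XD G k f y"
    using f' by eventually_elim (rule XD_eqI[symmetric])
  ultimately show ?thesis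
    unfolding differentiable_def by (blast intro: has_derivative_cong_nhds)
qed

section \<open>The second derivative of the Picone quotient\<close>

text \<open>
  The function is \<open>v t\<^sup>q\<close> with \<open>t = u / v\<close>, which confines the powers to one nonnegative function.
  The result is again of this kind, and so is ready for a second differentiation.
\<close>

lemma has_derivative_picone_quotient:
  fixes u v :: "'a::real_normed_vector \<Rightarrow> real"
  assumes u: "(u has_derivative u') (at x)" and v: "(v has_derivative v') (at x)"
    and nonneg: "\<forall>\<^sub>F y in nhds x. 0 \<le> u y" and "0 < v x" and "q > 1"
  shows "((\<lambda>y. u y powr q / v y powr (q - 1)) has_derivative
    (\<lambda>h. q * (u x / v x) powr (q - 1) * u' h - (q - 1) * (u x / v x) powr q * v' h)) (at x)"
proof -
  define t where "t y = u y / v y" for y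
  have "isCont v x"
    using v by (rule has_derivative_continuous)
  then have v_pos: "\<forall>\<^sub>F y in nhds x. 0 < v y"
    using \<open>0 < v x\<close> by (metis isCont_imp_eventually_pos)
  have t: "(t has_derivative (\<lambda>h. (u' h - t x * v' h) / v x)) (at x)"
    unfolding t_def using \<open>0 < v x\<close>
    by (auto intro!: derivative_eq_intros u v simp: field_simps power2_eq_square)
  have tq: "t x powr q = t x powr (q - 1) * t x"
    by (cases "t x = 0")
      (use \<open>0 < v x\<close> eventually_nhds_x_imp_x[OF nonneg] in \<open>auto simp: powr_diff t_def\<close>)
  have "\<forall>\<^sub>F y in nhds x. 0 \<le> t y"
    using nonneg v_pos by eventually_elim (simp add: t_def)
  from has_derivative_mult[OF v has_derivative_powr_nonneg[OF t this \<open>q > 1\<close>]]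
  have "((\<lambda>y. v y * t y powr q) has_derivative
      (\<lambda>h. v x * (q * t x powr (q - 1) * ((u' h - t x * v' h) / v x)) + v' h * t x powr q)) (at x)" .
  then have "((\<lambda>y. u y powr q / v y powr (q - 1)) has_derivative
      (\<lambda>h. v x * (q * t x powr (q - 1) * ((u' h - t x * v' h) / v x)) + v' h * t x powr q)) (at x)"
  proof (rule has_derivative_cong_nhds)
    show "\<forall>\<^sub>F y in nhds x. v y * t y powr q = u y powr q / v y powr (q - 1)"
      using nonneg v_pos by eventually_elim (simp add: t_def powr_divide powr_diff)
  qed
  moreover have "v x * (q * t x powr (q - 1) * ((u' h - t x * v' h) / v x)) + v' h * t x powr q
      = q * t x powr (q - 1) * u' h - (q - 1) * t x powr q * v' h" for h
    unfolding tq using \<open>0 < v x\<close> by (simp add: field_simps)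
  ultimately show ?thesis
    by (simp add: t_def)
qed

text \<open>
  The first derivative \<open>q t\<^sup>q\<^sup>-\<^sup>1 X u - (q - 1) t\<^sup>q X v\<close> is known in a neighbourhood of \<open>x\<close>, not only
  at \<open>x\<close>, because the hypotheses hold near \<open>x\<close>; hence it can be differentiated at \<open>x\<close>. With
  \<open>X t = (X u - t X v) / v\<close> the powers of \<open>t\<close> contribute
  \<open>q (q - 1) t\<^sup>q\<^sup>-\<^sup>2 X t (X u - t X v)\<close>, which is the square.
\<close>

lemma (in stratified_group) XD2_picone_quotient:
  assumes u: "twice_differentiable_at u x" and v: "twice_differentiable_at v x"
    and nonneg: "\<forall>\<^sub>F y in nhds x. 0 \<le> u y" and v_x: "0 < v x" and "q > 1"
  shows "XD2 G k (\<lambda>y. u y powr q / v y powr (q - 1)) x =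
    q * (u x / v x) powr (q - 1) * XD2 G k u x - (q - 1) * (u x / v x) powr q * XD2 G k v x
    + q * (q - 1) * (u x powr (q - 2) / v x powr (q - 1)) * (XD G k u x - u x / v x * XD G k v x)\<^sup>2"
proof -
  define t where "t y = u y / v y" for y
  define J where "J = jacobian_field G k x"
  note du = twice_differentiable_at_imp_eventually_differentiable[OF u]
    and dv = twice_differentiable_at_imp_eventually_differentiable[OF v]
  obtain u' v' where u': "(u has_derivative u') (at x)" and v': "(v has_derivative v') (at x)"
    using eventually_nhds_x_imp_x[OF du] eventually_nhds_x_imp_x[OF dv]
    unfolding differentiable_def by blast
  obtain U' V' where U': "(XD G k u has_derivative U') (at x)"
    and V': "(XD G k v has_derivative V') (at x)"
    using XD_differentiable[OF u] XD_differentiable[OF v] unfolding differentiable_def by blast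
  have XD_x: "XD G k u x = u' J" "XD G k v x = v' J" "XD2 G k u x = U' J" "XD2 G k v x = V' J"
    unfolding J_def by (intro XD_eqI u' v' U' V')+
  have u_x: "0 \<le> u x"
    using nonneg by (rule eventually_nhds_x_imp_x)
  have "isCont v x"
    using v' by (rule has_derivative_continuous)
  then have v_pos: "\<forall>\<^sub>F y in nhds x. 0 < v y"
    using v_x by (metis isCont_imp_eventually_pos)
  have t_nonneg: "\<forall>\<^sub>F y in nhds x. 0 \<le> t y"
    using nonneg v_pos by eventually_elim (simp add: t_def)
  have t': "(t has_derivative (\<lambda>h. (u' h - t x * v' h) / v x)) (at x)"
    unfolding t_def using v_x
    by (auto intro!: derivative_eq_intros u' v' simp: field_simps power2_eq_square)
  have "\<forall>\<^sub>F y in nhds x. \<forall>\<^sub>F z in nhds y. 0 \<le> u z"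
    using nonneg by (simp add: eventually_eventually)
  then have first: "\<forall>\<^sub>F y in nhds x. q * (t y powr (q - 1) * XD G k u y) - (q - 1) * (t y powr q * XD G k v y)
      = XD G k (\<lambda>y. u y powr q / v y powr (q - 1)) y"
    using v_pos du dv
  proof eventually_elim
    case (elim y)
    then obtain a b where a: "(u has_derivative a) (at y)" and b: "(v has_derivative b) (at y)"
      unfolding differentiable_def by blast
    show ?case
      using XD_eqI[OF has_derivative_picone_quotient[OF a b elim(1,2) \<open>q > 1\<close>]]
      by (simp add: XD_eqI[OF a] XD_eqI[OF b] t_def)
  qed
  have pow: "((\<lambda>y. t y powr (q - 1) * XD G k u y) has_derivative
      (\<lambda>h. t x powr (q - 1) * U' h + (q - 1) * t x powr (q - 2) * ((u' h - t x * v' h) / v x) * u' J)) (at x)"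
  proof (cases "u x = 0")
    case True
    \<comment> \<open>A zero of \<open>u\<close> is a local minimum, so \<open>X u\<close> vanishes where \<open>t\<^sup>q\<^sup>-\<^sup>1\<close> may fail to be differentiable.\<close>
    have "u' h = 0" for h
      using u' nonneg True by (rule has_derivative_zero_of_nonneg)
    then show ?thesis
      using has_derivative_mult_vanishing[OF isCont_powr_nonneg U', of t "q - 1"] t_nonneg \<open>q > 1\<close> XD_x(1)
        has_derivative_continuous[OF t']
      by (simp add: t_def True)
  next
    case False
    then have "t x > 0"
      using u_x v_x by (simp add: t_def)
    from has_derivative_mult[OF has_derivative_powr_pos[OF t' this, of "q - 1"] U']
    show ?thesis
      by (simp add: XD_x)
  qed
  have "((\<lambda>y. q * (t y powr (q - 1) * XD G k u y) - (q - 1) * (t y powr q * XD G k v y)) has_derivative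
      (\<lambda>h. q * (t x powr (q - 1) * U' h + (q - 1) * t x powr (q - 2) * ((u' h - t x * v' h) / v x) * u' J)
        - (q - 1) * (t x powr q * V' h + q * t x powr (q - 1) * ((u' h - t x * v' h) / v x) * v' J))) (at x)"
    unfolding XD_x(2)[symmetric]
    by (intro has_derivative_diff has_derivative_mult_right pow has_derivative_mult
        has_derivative_powr_nonneg t' t_nonneg \<open>q > 1\<close> V')
  then have "XD2 G k (\<lambda>y. u y powr q / v y powr (q - 1)) x =
      q * (t x powr (q - 1) * U' J + (q - 1) * t x powr (q - 2) * ((u' J - t x * v' J) / v x) * u' J)
      - (q - 1) * (t x powr q * V' J + q * t x powr (q - 1) * ((u' J - t x * v' J) / v x) * v' J)"
    unfolding J_def by (intro XD_eqI) (rule has_derivative_cong_nhds[OF _ first])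
  also have "\<dots> = q * t x powr (q - 1) * U' J - (q - 1) * t x powr q * V' J
      + q * (q - 1) * (t x powr (q - 2) / v x) * (u' J - t x * v' J)\<^sup>2"
  proof -
    have "t x powr (q - 1) = t x powr (q - 2) * t x"
      using powr_mult_base[of "t x" "q - 2"] u_x v_x by (simp add: t_def mult.commute)
    then show ?thesis
      using v_x by (simp add: field_simps power2_eq_square)
  qed
  also have "t x powr (q - 2) / v x = u x powr (q - 2) / v x powr (q - 1)"
    using powr_mult_base[of "v x" "q - 2"] u_x v_x by (simp add: t_def powr_divide mult.commute)
  finally show ?thesis
    by (simp add: XD_x t_def)
qed

section \<open>The sign of the second-order terms\<close>

text \<open>
  Young's inequality for \<open>a\<close> and \<open>b\<^sup>q\<^sup>-\<^sup>1\<close> with the conjugate exponents \<open>q\<close> and \<open>q / (q - 1)\<close>, multiplied by \<open>q\<close>.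
\<close>

lemma young_picone:
  fixes a b q :: real
  assumes "q > 1" "a \<ge> 0" "b \<ge> 0"
  shows "q * a * b powr (q - 1) \<le> a powr q + (q - 1) * b powr q"
proof -
  have "a * b powr (q - 1) \<le> a powr q / q + (b powr (q - 1)) powr (q / (q - 1)) / (q / (q - 1))"
    using assms by (intro Youngs_inequality) (auto simp: field_simps)
  also have "(b powr (q - 1)) powr (q / (q - 1)) = b powr q"
    using assms by (simp add: powr_powr)
  finally show ?thesis
    using assms by (simp add: field_simps)
qed

text \<open>
  These are the terms of \<open>L\<^sub>1\<close> without first derivatives, with \<open>A = X\<^sup>2 u\<close> and \<open>B = X\<^sup>2 v\<close>. The cross term is
  at most \<open>q |A| (t |B|)\<^sup>q\<^sup>-\<^sup>1\<close>, and Young's inequality for \<open>|A|\<close> and \<open>t |B|\<close> absorbs it.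
\<close>

lemma picone_young_nonneg:
  fixes q t A B :: real
  assumes "q > 1" "t \<ge> 0" "B < 0"
  shows "0 \<le> \<bar>A\<bar> powr q - q * t powr (q - 1) * A * B * \<bar>B\<bar> powr (q - 2) + (q - 1) * t powr q * \<bar>B\<bar> powr q"
proof -
  have B: "\<bar>B\<bar> powr (q - 1) = - B * \<bar>B\<bar> powr (q - 2)"
    using powr_mult_base[of "\<bar>B\<bar>" "q - 2"] \<open>B < 0\<close> by simp
  have "q * t powr (q - 1) * A * B * \<bar>B\<bar> powr (q - 2)
      = q * (t powr (q - 1) * \<bar>B\<bar> powr (q - 1)) * - A"
    unfolding B by simp
  also have "\<dots> \<le> q * (t powr (q - 1) * \<bar>B\<bar> powr (q - 1)) * \<bar>A\<bar>"
    using \<open>q > 1\<close> by (intro mult_left_mono) auto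
  also have "\<dots> = q * \<bar>A\<bar> * (t * \<bar>B\<bar>) powr (q - 1)"
    using \<open>t \<ge> 0\<close> by (simp add: powr_mult)
  also have "\<dots> \<le> \<bar>A\<bar> powr q + (q - 1) * (t * \<bar>B\<bar>) powr q"
    using assms by (intro young_picone) (auto simp: mult_nonneg_nonpos)
  finally show ?thesis
    using \<open>t \<ge> 0\<close> by (simp add: powr_mult)
qed

section \<open>Picone's identity almost everywhere\<close>

text \<open>
  Where \<open>f\<close> is continuous, the points of \<open>\<Omega>\<close> with \<open>f < 0\<close> form an open set; an open null set is empty.
\<close>

lemma AE_nonneg_imp_eventually_nonneg:
  fixes f :: "'a::euclidean_space \<Rightarrow> real"
  assumes "AE x\<in>\<Omega> in lebesgue. 0 \<le> f x" "open \<Omega>" "x \<in> \<Omega>" "\<forall>\<^sub>F y in nhds x. isCont f y"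
  shows "\<forall>\<^sub>F y in nhds x. 0 \<le> f y"
proof -
  obtain N where N: "\<And>y. y \<notin> N \<Longrightarrow> y \<in> \<Omega> \<Longrightarrow> 0 \<le> f y" "negligible N"
    using AE_E3[OF assms(1)] by (auto simp: negligible_iff_null_sets)
  obtain U where U: "open U" "x \<in> U" "\<And>y. y \<in> U \<Longrightarrow> isCont f y"
    using assms(4) unfolding eventually_nhds by blast
  let ?S = "(U \<inter> \<Omega>) \<inter> f -` {..<0}"
  have "continuous_on (U \<inter> \<Omega>) f"
    using U(3) by (simp add: continuous_at_imp_continuous_on)
  then have "open ?S"
    using U(1) assms(2) by (intro continuous_open_preimage) auto
  moreover have "negligible ?S"
    by (rule negligible_subset[OF N(2)]) (use N(1) in force)
  ultimately have "?S = {}"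
    using open_not_negligible by blast
  then have "\<forall>y\<in>U \<inter> \<Omega>. 0 \<le> f y"
    by force
  then show ?thesis
    using U(1,2) assms(2,3) unfolding eventually_nhds by (intro exI[of _ "U \<inter> \<Omega>"]) auto
qed

text \<open>
  The comparison of the two sides is made separately for each index: \<open>Y i\<close> collects the three terms
  covered by Young's inequality, and \<open>E i \<le> 0\<close> is the term with the square, whose sign is
  that of \<open>X\<^sub>i\<^sup>2 v\<close>.
\<close>

lemma (in stratified_group) picone_pointwise:
  assumes p: "\<And>i. i \<in> first_stratum \<sigma> \<Longrightarrow> p i > 1"
    and u: "twice_differentiable_at u x" and v: "twice_differentiable_at v x"
    and nonneg: "\<forall>\<^sub>F y in nhds x. 0 \<le> u y" and v_x: "0 < v x"
    and concave: "\<And>i. i \<in> first_stratum \<sigma> \<Longrightarrow> XD2 G i v x < 0"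
  shows "L1 G \<sigma> p u v x = R1 G \<sigma> p u v x \<and> R1 G \<sigma> p u v x \<ge> 0"
proof -
  let ?t = "u x / v x"
  have t: "0 \<le> ?t"
    using eventually_nhds_x_imp_x[OF nonneg] v_x by simp
  define E where "E i = p i * (p i - 1) * (u x powr (p i - 2) / v x powr (p i - 1))
      * \<bar>XD2 G i v x\<bar> powr (p i - 2) * XD2 G i v x * (XD G i u x - ?t * XD G i v x)\<^sup>2" for i
  define Y where "Y i = \<bar>XD2 G i u x\<bar> powr p i
      - p i * ?t powr (p i - 1) * XD2 G i u x * XD2 G i v x * \<bar>XD2 G i v x\<bar> powr (p i - 2)
      + (p i - 1) * ?t powr p i * \<bar>XD2 G i v x\<bar> powr p i" for i
  have L1: "L1 G \<sigma> p u v x = (\<Sum>i\<in>first_stratum \<sigma>. Y i - E i)"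
    by (simp add: L1_def Y_def E_def sum.distrib sum_subtractf)
  have R1: "R1 G \<sigma> p u v x = (\<Sum>i\<in>first_stratum \<sigma>. \<bar>XD2 G i u x\<bar> powr p i -
      XD2 G i (\<lambda>y. u y powr p i / v y powr (p i - 1)) x * \<bar>XD2 G i v x\<bar> powr (p i - 2) * XD2 G i v x)"
    by (simp add: R1_def sum_subtractf)
  have "Y i - E i = \<bar>XD2 G i u x\<bar> powr p i -
      XD2 G i (\<lambda>y. u y powr p i / v y powr (p i - 1)) x * \<bar>XD2 G i v x\<bar> powr (p i - 2) * XD2 G i v x"
    if "i \<in> first_stratum \<sigma>" for i
  proof -
    have sq: "\<bar>XD2 G i v x\<bar> powr p i = \<bar>XD2 G i v x\<bar> powr (p i - 2) * XD2 G i v x * XD2 G i v x"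
      using concave[OF that] by (simp add: powr_diff power2_eq_square)
    show ?thesis
      unfolding XD2_picone_quotient[OF u v nonneg v_x p[OF that]] Y_def E_def sq
      by (simp add: algebra_simps)
  qed
  then have "L1 G \<sigma> p u v x = R1 G \<sigma> p u v x"
    unfolding L1 R1 by (intro sum.cong) auto
  moreover have "0 \<le> Y i - E i" if "i \<in> first_stratum \<sigma>" for i
  proof -
    have "E i \<le> 0"
      unfolding E_def using p[OF that] concave[OF that]
      by (intro mult_nonpos_nonneg mult_nonneg_nonpos) auto
    moreover have "0 \<le> Y i"
      unfolding Y_def by (intro picone_young_nonneg p concave that t)
    ultimately show ?thesis
      by simp
  qed
  then have "0 \<le> L1 G \<sigma> p u v x"
    unfolding L1 by (rule sum_nonneg)
  ultimately show ?thesis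
    by simp
qed

theorem lemma3p1:
  fixes G :: "(real^'d) monoid" and \<sigma> :: "'d \<Rightarrow> nat" and r :: nat
    and \<Omega> :: "(real^'d) set" and p :: "'d \<Rightarrow> real" and u v :: "real^'d \<Rightarrow> real"
  assumes "stratified_group G \<sigma> r"
    and "open \<Omega>"
    and "\<And>i. i \<in> first_stratum \<sigma> \<Longrightarrow> p i > 1"
    and "AE x\<in>\<Omega> in lebesgue. twice_differentiable_at u x"
    and "AE x\<in>\<Omega> in lebesgue. twice_differentiable_at v x"
    and "AE x\<in>\<Omega> in lebesgue. u x \<ge> 0"
    and "AE x\<in>\<Omega> in lebesgue. v x > 0"
    and "\<And>i. i \<in> first_stratum \<sigma> \<Longrightarrow> AE x\<in>\<Omega> in lebesgue. XD2 G i v x < 0"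
  shows "AE x\<in>\<Omega> in lebesgue. L1 G \<sigma> p u v x = R1 G \<sigma> p u v x \<and> R1 G \<sigma> p u v x \<ge> 0"
proof -
  interpret stratified_group G \<sigma> r
    by (rule assms(1))
  have "AE x in lebesgue. \<forall>i\<in>first_stratum \<sigma>. x \<in> \<Omega> \<longrightarrow> XD2 G i v x < 0"
    by (rule AE_finite_allI) (auto intro: assms(8))
  with assms(4,5,7) show ?thesis
  proof eventually_elim
    case (elim x)
    show ?case
    proof
      assume x: "x \<in> \<Omega>"
      have u: "twice_differentiable_at u x"
        using elim(1) x by blast
      have "\<forall>\<^sub>F y in nhds x. isCont u y"
        using twice_differentiable_at_imp_eventually_differentiable[OF u]
        by eventually_elim (rule differentiable_imp_continuous_within)
      then have "\<forall>\<^sub>F y in nhds x. 0 \<le> u y"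
        by (rule AE_nonneg_imp_eventually_nonneg[OF assms(6,2) x])
      then show "L1 G \<sigma> p u v x = R1 G \<sigma> p u v x \<and> R1 G \<sigma> p u v x \<ge> 0"
        using elim x u by (intro picone_pointwise assms(3)) auto
    qed
  qed
qed

end
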